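(* For every non-trivial weak tree $T$, $DD_{\mathrm{m}}(T) = S(T) = e_{\mathrm{m}}^\infty(T)$.
   Context: Graphs are finite, simple and undirected; a graph is non-trivial if it has at least two vertices. A weak graph is one in which no vertex is adjacent to two or more vertices of degree one. Swap number: a dominating set $D$ of a graph $G$ is a swap set if there is a dominating set $D'$ of $G$ with $D\cap D'=\emptyset$, $|D|=|D'|$, such that $G$ contains a perfect matching between $D$ and $D'$ (a bijection $f:D\to D'$ with $x f(x)\in E(G)$ for all $x\in D$). $DD_{\mathrm{m}}(G)$ is the minimum cardinality of a swap set of $G$, and $DD_{\mathrm{m}}(G)=\infty$ if none exists. Simple star partitioning: a star is $K_{1,n}$, $n\ge 1$; a single vertex $K_1$ is also allowed as a (degenerate) star part of order 1. A leaf is a vertex of degree one. A simple star partitioning $P$ of a non-trivial tree $T$ is a partition of $V(T)$ such that (i) each part induces a star (possibly $K_1$); (ii) each vertex of $T$ adjacent to exactly one leaf forms a $K_2$ part of $P$ together with this leaf; (iii) any $K_1$ part is adjacent to at least two parts that are not $K_1$'s (two parts are adjacent if some edge of $T$ joins them). A part of order $k$ has weight $k-1$; the weight of $P$ is the sum of the weights of its parts. $S(T)$ is the minimum weight of a simple star partitioning of $T$. Eviction number (m-eternal eviction model): guards occupy the vertices of a dominating set $D$ (one guard per vertex). When a vertex $v\in D$ is attacked, each guard moves to a vertex in the closed neighborhood of its current vertex so that the guards then occupy a dominating set $D'$ (of the same size) with $v\notin D'$. $e_{\mathrm{m}}^\infty(G)$ is the minimum number of guards that can defend against every infinite sequence of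 attacks; i.e. the least $k$ for which there is a non-empty family $\mathcal{F}$ of dominating sets of size $k$ such that for all $D\in\mathcal{F}$ and $v\in D$ there are $D'\in\mathcal{F}$ with $v\notin D'$ and a bijection $f:D\to D'$ with $f(x)\in N[x]$ for all $x\in D$. *)

theory Defs
  imports
    "Graph_Theory.Kuratowski"
    "HOL-Library.Disjoint_Sets"
    "HOL-Library.Extended_Nat"
begin

text \<open>
  Finite simple undirected graphs are the locale \<^locale>\<open>graph\<close>: finite, loop-free, symmetric
  digraphs without parallel arcs. Each edge is a pair of opposite arcs, and hence a
  \<^const>\<open>pre_digraph.cycle\<close> of length 2; the library's \<^const>\<open>tree\<close> therefore fails for every
  symmetric graph that has an edge. An undirected cycle is one of length at least 3.
\<close>

definition undirected_tree :: "('a, 'b) pre_digraph \<Rightarrow> bool" where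
  "undirected_tree G \<longleftrightarrow>
     connected G \<and> \<not> (\<exists>p. pre_digraph.cycle G p \<and> 3 \<le> length p)"

definition leaf :: "('a, 'b) pre_digraph \<Rightarrow> 'a \<Rightarrow> bool" where
  "leaf G v \<longleftrightarrow> v \<in> verts G \<and> out_degree G v = 1"

definition leaf_neighbours :: "('a, 'b) pre_digraph \<Rightarrow> 'a \<Rightarrow> 'a set" where
  "leaf_neighbours G v = {u. leaf G u \<and> v \<rightarrow>\<^bsub>G\<^esub> u}"

definition weak_graph :: "('a, 'b) pre_digraph \<Rightarrow> bool" where
  "weak_graph G \<longleftrightarrow> \<not> (\<exists>v \<in> verts G. 2 \<le> card (leaf_neighbours G v))"

definition dominating_set :: "('a, 'b) pre_digraph \<Rightarrow> 'a set \<Rightarrow> bool" where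
  "dominating_set G D \<longleftrightarrow> D \<subseteq> verts G \<and> (\<forall>v \<in> verts G - D. \<exists>u \<in> D. u \<rightarrow>\<^bsub>G\<^esub> v)"

definition swap_set :: "('a, 'b) pre_digraph \<Rightarrow> 'a set \<Rightarrow> bool" where
  "swap_set G D \<longleftrightarrow> dominating_set G D \<and>
     (\<exists>D'. dominating_set G D' \<and> D \<inter> D' = {} \<and> card D = card D' \<and>
        (\<exists>f. bij_betw f D D' \<and> (\<forall>x \<in> D. x \<rightarrow>\<^bsub>G\<^esub> f x)))"

text \<open>
  All three parameters are infima in \<^typ>\<open>enat\<close>: the minimum if the set is nonempty, \<open>\<infinity>\<close> otherwise.
\<close>

definition swap_number :: "('a, 'b) pre_digraph \<Rightarrow> enat" where
  "swap_number G = Inf {enat (card D) | D. swap_set G D}"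

definition star_part :: "('a, 'b) pre_digraph \<Rightarrow> 'a set \<Rightarrow> bool" where
  "star_part G A \<longleftrightarrow> K\<^bsub>1\<^esub> (G \<restriction> A) \<or> (\<exists>n \<ge> 1. K\<^bsub>1,n\<^esub> (G \<restriction> A))"

definition parts_adjacent :: "('a, 'b) pre_digraph \<Rightarrow> 'a set \<Rightarrow> 'a set \<Rightarrow> bool" where
  "parts_adjacent G A B \<longleftrightarrow> A \<noteq> B \<and> (\<exists>a \<in> A. \<exists>b \<in> B. a \<rightarrow>\<^bsub>G\<^esub> b)"

definition simple_star_partitioning :: "('a, 'b) pre_digraph \<Rightarrow> 'a set set \<Rightarrow> bool" where
  "simple_star_partitioning G P \<longleftrightarrow> partition_on (verts G) P \<and>
     (\<forall>A \<in> P. star_part G A) \<and>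
     (\<forall>v \<in> verts G. \<forall>l. leaf_neighbours G v = {l} \<longrightarrow> {v, l} \<in> P) \<and>
     (\<forall>A \<in> P. card A = 1 \<longrightarrow> 2 \<le> card {B \<in> P. card B \<noteq> 1 \<and> parts_adjacent G A B})"

definition partition_weight :: "'a set set \<Rightarrow> nat" where
  "partition_weight P = (\<Sum>A \<in> P. card A - 1)"

definition min_star_weight :: "('a, 'b) pre_digraph \<Rightarrow> enat" where
  "min_star_weight G = Inf {enat (partition_weight P) | P. simple_star_partitioning G P}"

definition closed_neighbourhood :: "('a, 'b) pre_digraph \<Rightarrow> 'a \<Rightarrow> 'a set" where
  "closed_neighbourhood G x = insert x {y. x \<rightarrow>\<^bsub>G\<^esub> y}"

definition eviction_family :: "('a, 'b) pre_digraph \<Rightarrow> nat \<Rightarrow> 'a set set \<Rightarrow> bool" where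
  "eviction_family G k F \<longleftrightarrow> F \<noteq> {} \<and>
     (\<forall>D \<in> F. dominating_set G D \<and> card D = k) \<and>
     (\<forall>D \<in> F. \<forall>v \<in> D. \<exists>D' \<in> F. v \<notin> D' \<and>
        (\<exists>f. bij_betw f D D' \<and> (\<forall>x \<in> D. f x \<in> closed_neighbourhood G x)))"

definition eviction_number :: "('a, 'b) pre_digraph \<Rightarrow> enat" where
  "eviction_number G = Inf {enat k | k. \<exists>F. eviction_family G k F}"

end

theory Submission
  imports Defs
begin

text \<open>
  Root the tree at a leaf \<open>r\<close> with only child \<open>s\<close>. A bottom-up recursion assigns to every vertex
  \<open>v\<close> a kind and a number \<open>min_edges v\<close>; all three parameters turn out to equal
  \<open>min_edges s + 1\<close>.

  A swap set amounts to a matching such that every unmatched vertex has at least two matched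
  neighbours: the tree structure allows the matching edges to be oriented so that every unmatched
  vertex sees both sides. Its edges and the unmatched vertices form a simple star partitioning,
  and the two sides alternate as an eviction family, so it remains to find such a matching with
  \<open>min_edges s + 1\<close> edges and to show that this number bounds the other two parameters from below.

  Here \<open>min_edges v\<close> is the least number of edges that a solution can spend strictly below \<open>v\<close>.
  At that cost, a supporting \<open>v\<close> can be matched to a child, a neutral \<open>v\<close> can stay
  unmatched, a needy \<open>v\<close> can stay unmatched provided that its parent is matched, and a demanding
  \<open>v\<close> has to be matched to its parent. For guards, the analogue of the last statement is that a
  subtree at a demanding \<open>v\<close> which holds only \<open>min_edges v\<close> guards forces a guard on the parent
  of \<open>v\<close>. It holds although \<open>v\<close> may be dominated from below at the moment: attacking the guard
  on the only supporting child of a needy child of \<open>v\<close> forces a further guard into the subtree,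
  and that guard has to come from the parent.
\<close>

section \<open>Rooted trees\<close>

datatype kind = Supporting | Neutral | Needy | Demanding

text \<open>Any function that drops along \<open>par\<close> can serve as \<open>depth\<close>,
  which makes it a measure for top-down recursion. The value \<open>par r\<close> is arbitrary,
  hence the guards \<open>v \<noteq> r\<close>.\<close>

locale rooted_tree =
  fixes V :: "'a set" and adj :: "'a \<Rightarrow> 'a \<Rightarrow> bool" and r :: 'a
    and par :: "'a \<Rightarrow> 'a" and depth :: "'a \<Rightarrow> nat"
  assumes finite_V: "finite V"
    and root_in: "r \<in> V"
    and par_in: "v \<in> V \<Longrightarrow> v \<noteq> r \<Longrightarrow> par v \<in> V"
    and depth_par: "v \<in> V \<Longrightarrow> v \<noteq> r \<Longrightarrow> depth (par v) < depth v"
    and adj_iff: "adj x y \<longleftrightarrow>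
      x \<in> V \<and> y \<in> V \<and> (x \<noteq> r \<and> par x = y \<or> y \<noteq> r \<and> par y = x)"
begin

definition children :: "'a \<Rightarrow> 'a set" where
  "children v = {w \<in> V. w \<noteq> r \<and> par w = v}"

lemma childrenD:
  assumes "w \<in> children v"
  shows "w \<in> V" "w \<noteq> r" "par w = v" "v \<in> V" "depth v < depth w"
  using assms par_in depth_par by (auto simp: children_def)

lemma in_children_par: "v \<in> V \<Longrightarrow> v \<noteq> r \<Longrightarrow> v \<in> children (par v)"
  by (simp add: children_def)

lemma finite_children [simp]: "finite (children v)"
  using finite_V by (simp add: children_def)

lemma adj_iff_children: "adj x y \<longleftrightarrow> x \<in> children y \<or> y \<in> children x"
  using par_in by (auto simp: adj_iff children_def)

text \<open>The deepest vertex of a triangle would have both others as its parent. This later puts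
  two matched neighbours of an unmatched vertex on different matching edges.\<close>

lemma adj_triangle_free:
  assumes "adj x y" "adj y z"
  shows "\<not> adj x z"
proof
  assume "adj x z"
  have down: "depth a \<noteq> depth b \<and> (depth b < depth a \<longrightarrow> par a = b) \<and> (depth a < depth b \<longrightarrow> par b = a)"
    if "adj a b" for a b
    using that unfolding adj_iff_children
  proof
    assume "a \<in> children b"
    then show ?thesis using childrenD(3,5)[of a b] by simp
  next
    assume "b \<in> children a"
    then show ?thesis using childrenD(3,5)[of b a] by simp
  qed
  note xy = down[OF assms(1)] and yz = down[OF assms(2)] and xz = down[OF \<open>adj x z\<close>]
  consider "depth y < depth x" "depth z < depth x" | "depth x < depth y" "depth z < depth y"
    | "depth x < depth z" "depth y < depth z"
    using xy yz xz by linarith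
  then show False using xy yz xz by cases auto
qed

lemma adj_par: "v \<in> V \<Longrightarrow> v \<noteq> r \<Longrightarrow> adj v (par v)" "v \<in> V \<Longrightarrow> v \<noteq> r \<Longrightarrow> adj (par v) v"
  by (auto simp: adj_iff_children in_children_par)

text \<open>The complement of the depth rather than the height of a subtree: a measure that drops
  from a vertex to its children, for bottom-up recursion and induction.\<close>

definition height :: "'a \<Rightarrow> nat" where
  "height v = Max (depth ` V) - depth v"

lemma height_child: "w \<in> children v \<Longrightarrow> height w < height v"
proof -
  assume "w \<in> children v"
  then have "depth v < depth w" "depth w \<le> Max (depth ` V)"
    using finite_V by (auto dest: childrenD)
  then show ?thesis unfolding height_def by linarith
qed

lemma children_induct [consumes 1, case_names children]:
  assumes "v \<in> V" and "\<And>v. v \<in> V \<Longrightarrow> (\<And>w. w \<in> children v \<Longrightarrow> P w) \<Longrightarrow> P v"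
  shows "P v"
  using assms(1)
  by (induction v rule: measure_induct_rule[of height])
    (use assms(2) in \<open>blast dest: height_child childrenD(1)\<close>)

section \<open>Subtrees and counting in them\<close>

inductive_set subtree :: "'a \<Rightarrow> 'a set" for v where
  self: "v \<in> subtree v"
| child: "x \<in> subtree v \<Longrightarrow> w \<in> children x \<Longrightarrow> w \<in> subtree v"

lemma subtree_depth: "x \<in> subtree v \<Longrightarrow> depth v \<le> depth x"
  by (induction rule: subtree.induct) (auto dest: childrenD)

lemma subtree_par: "x \<in> subtree v \<Longrightarrow> x = v \<or> x \<in> V \<and> x \<noteq> r \<and> par x \<in> subtree v"
  by (induction rule: subtree.induct) (auto dest: childrenD)

lemma subtree_child_subset: "w \<in> children v \<Longrightarrow> subtree w \<subseteq> subtree v"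
proof
  fix x assume w: "w \<in> children v" and "x \<in> subtree w"
  from this(2) show "x \<in> subtree v"
    by induction (use w in \<open>auto intro: subtree.intros\<close>)
qed

lemma subtree_unfold: "subtree v = insert v (\<Union>w\<in>children v. subtree w)"
proof
  show "subtree v \<subseteq> insert v (\<Union>w\<in>children v. subtree w)"
  proof
    fix x assume "x \<in> subtree v"
    then show "x \<in> insert v (\<Union>w\<in>children v. subtree w)"
      by induction (auto intro: subtree.intros)
  qed
qed (use subtree_child_subset in \<open>auto intro: subtree.intros\<close>)

lemma notin_subtree_child: "w \<in> children v \<Longrightarrow> v \<notin> subtree w"
  using subtree_depth childrenD(5) by fastforce

lemma subtree_disjoint:
  assumes "w \<in> children v" "w' \<in> children v" "w \<noteq> w'"
  shows "subtree w \<inter> subtree w' = {}"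
proof -
  have "x \<notin> subtree w'" if "x \<in> subtree w" for x
    using that
  proof induction
    case self
    then show ?case using assms subtree_par notin_subtree_child childrenD by metis
  next
    case (child x y)
    then show ?case using assms subtree_par notin_subtree_child childrenD by metis
  qed
  then show ?thesis by auto
qed

lemma subtree_root: "subtree r = V"
proof
  show "subtree r \<subseteq> V" using subtree_par root_in by blast
  have "x \<in> V \<longrightarrow> x \<in> subtree r" for x
  proof (induction x rule: measure_induct_rule[of depth])
    case (less x)
    then show ?case
      by (metis depth_par in_children_par par_in subtree.child subtree.self)
  qed
  then show "V \<subseteq> subtree r" by blast
qed

text \<open>This disjoint split runs parallel to the recursion for \<open>min_edges\<close>, so that
  counts can be compared child by child.\<close>

lemma card_Int_subtree:
  assumes "finite U"
  shows "card (U \<inter> subtree v) = of_bool (v \<in> U) + (\<Sum>w\<in>children v. card (U \<inter> subtree w))"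
proof -
  have "card (\<Union>w\<in>children v. U \<inter> subtree w) = (\<Sum>w\<in>children v. card (U \<inter> subtree w))"
    using assms subtree_disjoint by (intro card_UN_disjoint) auto
  moreover have "U \<inter> subtree v = (U \<inter> {v}) \<union> (\<Union>w\<in>children v. U \<inter> subtree w)"
    by (subst subtree_unfold) auto
  moreover have "card ((U \<inter> {v}) \<union> (\<Union>w\<in>children v. U \<inter> subtree w))
      = card (U \<inter> {v}) + card (\<Union>w\<in>children v. U \<inter> subtree w)"
    using assms notin_subtree_child by (intro card_Un_disjoint) auto
  ultimately show ?thesis by auto
qed

section \<open>Kinds of vertices and the recursive cost\<close>

text \<open>A demanding child can be matched to \<open>v\<close>. Failing that, a needy child wants
  \<open>v\<close> matched, and only the parent of \<open>v\<close> is available at minimum cost.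
  Otherwise the supporting children are the matched ones: an unmatched \<open>v\<close> needs two
  matched neighbours, of which the parent can be one. Leaves fall under
  \<open>k = 0\<close>.\<close>

function kind :: "'a \<Rightarrow> kind" where
  "kind v =
    (if \<exists>w \<in> children v. kind w = Demanding then Supporting
     else if \<exists>w \<in> children v. kind w = Needy then Demanding
     else let k = (\<Sum>w \<in> children v. of_bool (kind w = Supporting)) in
       if k = (0::nat) then Demanding else if k = 1 then Needy else Neutral)"
  by auto
termination by (relation "measure height") (auto simp: height_child)

declare kind.simps [simp del]

text \<open>Each demanding child costs one more edge: either the edge that matches it to
  \<open>v\<close> or an extra edge below it.\<close>

function min_edges :: "'a \<Rightarrow> nat" where
  "min_edges v = (\<Sum>w \<in> children v. min_edges w + of_bool (kind w = Demanding))"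
  by auto
termination by (relation "measure height") (auto simp: height_child)

declare min_edges.simps [simp del]

lemma kind_unfold:
  "kind v =
    (if \<exists>w \<in> children v. kind w = Demanding then Supporting
     else if \<exists>w \<in> children v. kind w = Needy then Demanding
     else let k = card {w \<in> children v. kind w = Supporting} in
       if k = 0 then Demanding else if k = 1 then Needy else Neutral)"
  by (subst kind.simps) (simp add: Int_def)

lemma kind_Supporting_iff: "kind v = Supporting \<longleftrightarrow> (\<exists>w\<in>children v. kind w = Demanding)"
  by (subst kind_unfold) (simp add: Let_def)

lemma kind_child_Needy:
  "w \<in> children v \<Longrightarrow> kind w = Needy \<Longrightarrow> kind v = Supporting \<or> kind v = Demanding"
  by (subst (1 2) kind_unfold) (auto simp add: Let_def)

text \<open>There is no demanding child; without a needy child there is no supporting one either, so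
  only neutral children remain. The second disjunct covers leaves.\<close>

lemma kind_DemandingD:
  assumes "kind v = Demanding"
  shows "(\<exists>w\<in>children v. kind w = Needy) \<or> (\<forall>w\<in>children v. kind w = Neutral)"
proof (rule disjCI)
  assume "\<not> (\<forall>w\<in>children v. kind w = Neutral)"
  then obtain w where w: "w \<in> children v" "kind w \<noteq> Neutral" by blast
  have "kind w \<noteq> Demanding" using assms w kind_Supporting_iff by force
  moreover have "\<exists>w\<in>children v. kind w = Needy" if "kind w = Supporting"
    using assms w that kind_unfold[of v] by (auto simp: Let_def split: if_splits)
  ultimately show "\<exists>w\<in>children v. kind w = Needy"
    using w by (cases "kind w") auto
qed

lemma kind_NeedyD:
  assumes "kind v = Needy"
  obtains h where "h \<in> children v" "kind h = Supporting"
    "\<And>w. w \<in> children v \<Longrightarrow> kind w = Supporting \<Longrightarrow> w = h"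
proof -
  have "card {w \<in> children v. kind w = Supporting} = 1"
    using assms kind_unfold[of v] by (auto simp: Let_def split: if_splits)
  then show ?thesis using that by (auto simp: card_1_singleton_iff)
qed

lemma kind_NeutralD:
  assumes "kind v = Neutral"
  obtains h h' where "h \<in> children v" "kind h = Supporting"
    "h' \<in> children v" "kind h' = Supporting" "h \<noteq> h'"
proof -
  let ?k = "card {w \<in> children v. kind w = Supporting}"
  have "?k \<noteq> 0" "?k \<noteq> 1"
    using assms kind_unfold[of v] by (auto simp: Let_def split: if_splits)
  then have "\<not> ?k \<le> Suc 0" by linarith
  then show ?thesis using that by (auto simp: card_le_Suc0_iff_eq)
qed

text \<open>Without demanding children, \<open>min_edges v\<close> is the plain sum over the
  children, so a total at the minimum leaves no slack at any child. The function \<open>g\<close>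
  will count guards or edges.\<close>

lemma low_subtree_children:
  assumes "kind v \<noteq> Supporting"
    and "\<And>w. w \<in> children v \<Longrightarrow> min_edges w \<le> g w"
    and "(\<Sum>w\<in>children v. g w) \<le> min_edges v" "w \<in> children v"
  shows "g w = min_edges w"
proof -
  have "min_edges v = (\<Sum>w\<in>children v. min_edges w)"
    using assms(1) kind_Supporting_iff by (subst min_edges.simps) auto
  then have "(\<Sum>w\<in>children v. min_edges w) = (\<Sum>w\<in>children v. g w)"
    using assms(2,3) by (intro antisym) (auto intro: sum_mono)
  then show ?thesis
    using sum_mono_inv[of min_edges "children v" g w] assms by auto
qed

section \<open>Lower bound for the eviction number\<close>

text \<open>Guards enter a subtree only along the edge from \<open>par v\<close> to
  \<open>v\<close>, which requires a guard on \<open>par v\<close> before the move and one on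
  \<open>v\<close> after it.\<close>

lemma card_subtree_move_le:
  assumes "finite D" "bij_betw f D D'" "\<And>x. x \<in> D \<Longrightarrow> f x = x \<or> adj x (f x)"
    and "par v \<notin> D \<or> v \<notin> D'"
  shows "card (D' \<inter> subtree v) \<le> card (D \<inter> subtree v)"
proof -
  have "D' \<inter> subtree v \<subseteq> f ` (D \<inter> subtree v)"
  proof
    fix y assume y: "y \<in> D' \<inter> subtree v"
    then obtain x where x: "x \<in> D" "f x = y"
      using assms(2) by (auto simp: bij_betw_def)
    have "x \<in> subtree v"
    proof (cases "x = y \<or> x \<in> children y")
      case True
      then show ?thesis using y by (auto intro: subtree.child)
    next
      case False
      then have "y \<in> children x" using assms(3)[OF x(1)] x by (auto simp: adj_iff_children)
      then have "par y = x" by (rule childrenD)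
      then show ?thesis using subtree_par[of y v] y x assms(4) by auto
    qed
    then show "y \<in> f ` (D \<inter> subtree v)" using x by auto
  qed
  then have "card (D' \<inter> subtree v) \<le> card (f ` (D \<inter> subtree v))"
    using assms(1) by (intro card_mono) auto
  also have "\<dots> \<le> card (D \<inter> subtree v)"
    using assms(1) by (intro card_image_le) auto
  finally show ?thesis .
qed

text \<open>Both claims go through one induction: the bound at \<open>v\<close> uses the second
  claim at demanding children, and the second claim uses the bound further down.\<close>

lemma eviction_subtree_bound:
  assumes F_subset: "\<And>D. D \<in> F \<Longrightarrow> D \<subseteq> V"
    and F_dom: "\<And>D v. D \<in> F \<Longrightarrow> v \<in> V \<Longrightarrow> v \<notin> D \<Longrightarrow> \<exists>u\<in>D. adj u v"
    and F_evict: "\<And>D v. D \<in> F \<Longrightarrow> v \<in> D \<Longrightarrow> \<exists>D'\<in>F. v \<notin> D' \<and>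
      (\<exists>f. bij_betw f D D' \<and> (\<forall>x\<in>D. f x = x \<or> adj x (f x)))"
    and "v \<in> V" "D \<in> F"
  shows "min_edges v \<le> card (D \<inter> subtree v) \<and>
    (v \<noteq> r \<longrightarrow> kind v = Demanding \<longrightarrow> card (D \<inter> subtree v) = min_edges v \<longrightarrow> par v \<in> D)"
  using assms(4,5)
proof (induction v arbitrary: D rule: measure_induct_rule[of height])
  case (less v)
  have finF: "finite D" if "D \<in> F" for D
    using F_subset[OF that] finite_V finite_subset by blast
  have bound: "min_edges w \<le> card (D \<inter> subtree w)" if "height w < height v" "w \<in> V" "D \<in> F" for w D
    using less.IH that by blast
  have demand: "v \<in> D" if "w \<in> children v" "D \<in> F" "kind w = Demanding"
    "card (D \<inter> subtree w) = min_edges w" for w D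
    using less.IH[of w D] that height_child childrenD by metis
  \<comment> \<open>Tightness propagates downwards: this is applied to \<open>v\<close>, to its
    children and to its grandchildren.\<close>
  have low: "u \<notin> D \<and> (\<forall>w\<in>children u. card (D \<inter> subtree w) = min_edges w)"
    if "height u \<le> height v" "D \<in> F" "kind u \<noteq> Supporting" "card (D \<inter> subtree u) \<le> min_edges u" for u D
  proof -
    have *: "min_edges w \<le> card (D \<inter> subtree w)" if "w \<in> children u" for w
      using bound \<open>D \<in> F\<close> that height_child childrenD(1) \<open>height u \<le> height v\<close> by fastforce
    have sum: "card (D \<inter> subtree u) = of_bool (u \<in> D) + (\<Sum>w\<in>children u. card (D \<inter> subtree w))"
      by (rule card_Int_subtree) (simp add: finF that)
    then have all: "card (D \<inter> subtree w) = min_edges w" if "w \<in> children u" for w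
      using low_subtree_children[of u "\<lambda>w. card (D \<inter> subtree w)" w] * that
        \<open>kind u \<noteq> Supporting\<close> \<open>card (D \<inter> subtree u) \<le> min_edges u\<close> by simp
    have "min_edges u = (\<Sum>w\<in>children u. min_edges w)"
      using \<open>kind u \<noteq> Supporting\<close> kind_Supporting_iff by (subst min_edges.simps) auto
    then have "u \<notin> D"
      using sum all \<open>card (D \<inter> subtree u) \<le> min_edges u\<close> by (cases "u \<in> D") auto
    then show ?thesis using all by auto
  qed
  \<comment> \<open>With \<open>v\<close> empty, the induction hypothesis gives every demanding
    child a surplus guard, which pays for the \<open>of_bool\<close> summand.\<close>
  have unoccupied: "min_edges v \<le> card (D \<inter> subtree v)" if "D \<in> F" "v \<notin> D" for D
  proof -
    have "min_edges w + of_bool (kind w = Demanding) \<le> card (D \<inter> subtree w)" if "w \<in> children v" for w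
    proof -
      have "min_edges w \<le> card (D \<inter> subtree w)"
        using bound \<open>D \<in> F\<close> that height_child childrenD by blast
      moreover have "card (D \<inter> subtree w) \<noteq> min_edges w" if "kind w = Demanding"
        using demand \<open>w \<in> children v\<close> that \<open>D \<in> F\<close> \<open>v \<notin> D\<close> by blast
      ultimately show ?thesis by (cases "kind w = Demanding") auto
    qed
    then have "min_edges v \<le> (\<Sum>w\<in>children v. card (D \<inter> subtree w))"
      by (subst min_edges.simps) (intro sum_mono)
    then show ?thesis using card_Int_subtree[of D v] finF that by simp
  qed
  have "min_edges v \<le> card (D \<inter> subtree v)"
  proof (cases "v \<in> D")
    case True
    \<comment> \<open>Attacking \<open>v\<close> itself reduces to the unoccupied case:
      \<open>v\<close> is empty afterwards, so no guard has entered the subtree.\<close>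
    then obtain D' f where "D' \<in> F" "v \<notin> D'" "bij_betw f D D'" "\<forall>x\<in>D. f x = x \<or> adj x (f x)"
      using F_evict \<open>D \<in> F\<close> by meson
    then show ?thesis
      using unoccupied[of D'] card_subtree_move_le[of D f D' v] finF \<open>D \<in> F\<close> by fastforce
  qed (use unoccupied less in auto)
  moreover have "par v \<in> D" if "v \<noteq> r" "kind v = Demanding" "card (D \<inter> subtree v) = min_edges v"
  proof -
    have v: "v \<notin> D" "\<And>w. w \<in> children v \<Longrightarrow> card (D \<inter> subtree w) = min_edges w"
      using low[of v D] that \<open>D \<in> F\<close> by auto
    from kind_DemandingD[OF \<open>kind v = Demanding\<close>] show ?thesis
    proof
      assume "\<exists>w\<in>children v. kind w = Needy"
      then obtain w where w: "w \<in> children v" "kind w = Needy" by blast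
      then obtain h where h: "h \<in> children w" "kind h = Supporting"
        "\<And>x. x \<in> children w \<Longrightarrow> kind x = Supporting \<Longrightarrow> x = h"
        by (metis kind_NeedyD)
      \<comment> \<open>Both \<open>w\<close> and its parent \<open>v\<close> are empty, so a child
        of \<open>w\<close> dominates it; an occupied child must be supporting, hence is
        \<open>h\<close>. This is proved for every tight member of \<open>F\<close>, so that it also
        applies after an attack.\<close>
      have helper: "h \<in> D" if "D \<in> F" "card (D \<inter> subtree v) \<le> min_edges v" for D
      proof -
        have v: "v \<notin> D" "card (D \<inter> subtree w) = min_edges w"
          using low[of v D] that \<open>kind v = Demanding\<close> w by auto
        then have w': "w \<notin> D" "\<And>x. x \<in> children w \<Longrightarrow> card (D \<inter> subtree x) = min_edges x"
          using low[of w D] that w height_child[OF w(1)] by auto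
        obtain x where x: "x \<in> D" "adj x w"
          using F_dom w'(1) \<open>D \<in> F\<close> childrenD(1)[OF w(1)] by blast
        have "x \<in> children w" using x v childrenD(3)[OF w(1)] childrenD(3)[of w x]
          by (auto simp: adj_iff_children)
        moreover have "kind x = Supporting"
          using low[of x D] w'(2) \<open>x \<in> children w\<close> height_child[OF w(1)] height_child[of x w] x \<open>D \<in> F\<close>
          by force
        ultimately show ?thesis using h x by auto
      qed
      then have "h \<in> D" using that \<open>D \<in> F\<close> by simp
      \<comment> \<open>After an attack on \<open>h\<close> the subtree at \<open>v\<close> can no
        longer be tight, so a guard has come in from \<open>par v\<close>.\<close>
      then obtain D' f where D': "D' \<in> F" "h \<notin> D'" "bij_betw f D D'" "\<forall>x\<in>D. f x = x \<or> adj x (f x)"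
        using F_evict[of D h] \<open>D \<in> F\<close> by auto
      then have "card (D' \<inter> subtree v) > card (D \<inter> subtree v)"
        using helper[of D'] that(3) by (metis not_le_imp_less)
      then show ?thesis
        using card_subtree_move_le[of D f D' v] D' finF \<open>D \<in> F\<close> by fastforce
    next
      assume neutral: "\<forall>w\<in>children v. kind w = Neutral"
      \<comment> \<open>Tight neutral children are empty, so only the parent can dominate
        \<open>v\<close>.\<close>
      obtain x where x: "x \<in> D" "adj x v" using F_dom v(1) less.prems by blast
      have "x \<notin> children v"
        using low[of x D] v(2) x neutral height_child[of x v] \<open>D \<in> F\<close> by fastforce
      then show ?thesis using x childrenD by (auto simp: adj_iff_children)
    qed
  qed
  ultimately show ?case by blast
qed

section \<open>Lower bound for star partitionings\<close>

text \<open>A set \<open>U\<close> of vertices encodes the set of edges from the members of \<open>U\<close> to their parents.\<close>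

definition covered :: "'a set \<Rightarrow> 'a \<Rightarrow> bool" where
  "covered U v \<longleftrightarrow> v \<in> U \<or> (\<exists>w\<in>children v. w \<in> U)"

text \<open>The same induction as for guards. Here \<open>n v\<close> includes the edges from
  \<open>v\<close> to its children but not the edge from \<open>v\<close> to its parent, and two
  covered neighbours replace domination and attack.\<close>

lemma edge_cover_subtree_bound:
  assumes "finite U"
    and nbrs: "\<And>v. v \<in> V \<Longrightarrow> \<not> covered U v \<Longrightarrow>
      \<exists>x y. x \<noteq> y \<and> adj v x \<and> adj v y \<and> covered U x \<and> covered U y"
    and "v \<in> V"
  defines "n \<equiv> \<lambda>v. \<Sum>w\<in>children v. card (U \<inter> subtree w)"
  shows "min_edges v \<le> n v \<and> (kind v = Demanding \<longrightarrow> n v = min_edges v \<longrightarrow> v \<in> U)"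
  using assms(3)
proof (induction v rule: measure_induct_rule[of height])
  case (less v)
  have c: "card (U \<inter> subtree w) = n w + of_bool (w \<in> U)" for w
    using card_Int_subtree[OF assms(1), of w] by (simp add: n_def)
  have bound: "min_edges w \<le> n w" if "height w < height v" "w \<in> V" for w
    using less.IH that by blast
  have low: "\<forall>w\<in>children u. w \<notin> U \<and> n w = min_edges w"
    if "height u \<le> height v" "kind u \<noteq> Supporting" "n u \<le> min_edges u" for u
  proof
    fix w assume w: "w \<in> children u"
    have *: "min_edges w \<le> n w" if "w \<in> children u" for w
      using bound[of w] that height_child[of w u] childrenD(1) \<open>height u \<le> height v\<close> by fastforce
    \<comment> \<open>This count contains the upward edge of \<open>w\<close>, whereas
      \<open>n w\<close> alone already reaches \<open>min_edges w\<close>; hence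
      \<open>w \<notin> U\<close>.\<close>
    have "card (U \<inter> subtree w) = min_edges w"
    proof (rule low_subtree_children)
      show "min_edges w \<le> card (U \<inter> subtree w)" if "w \<in> children u" for w
        using *[OF that] c[of w] by linarith
    qed (use that w in \<open>auto simp: n_def\<close>)
    with *[OF w] show "w \<notin> U \<and> n w = min_edges w" by (auto simp: c)
  qed
  have "min_edges w + of_bool (kind w = Demanding) \<le> card (U \<inter> subtree w)" if "w \<in> children v" for w
    using less.IH[of w] that height_child[of w v] childrenD(1) by (force simp: c)
  then have "min_edges v \<le> n v"
    unfolding n_def by (subst min_edges.simps) (intro sum_mono)
  moreover have "v \<in> U" if "kind v = Demanding" "n v = min_edges v"
  proof -
    have v: "w \<notin> U" "n w = min_edges w" if "w \<in> children v" for w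
      using low[of v] that \<open>kind v = Demanding\<close> \<open>n v = min_edges v\<close> by auto
    from kind_DemandingD[OF \<open>kind v = Demanding\<close>] show ?thesis
    proof
      assume "\<exists>w\<in>children v. kind w = Needy"
      then obtain w where w: "w \<in> children v" "kind w = Needy" by blast
      then obtain h where h: "\<And>x. x \<in> children w \<Longrightarrow> kind x = Supporting \<Longrightarrow> x = h"
        by (metis kind_NeedyD)
      have w': "x \<notin> U" "n x = min_edges x" if "x \<in> children w" for x
        using low[of w] that w v height_child[OF w(1)] by auto
      \<comment> \<open>A covered child of \<open>w\<close> has no upward edge, so it has an edge
        below; as its subtree is tight, it must be supporting.\<close>
      have only: "x = h" if "x \<in> children w" "covered U x" for x
      proof -
        have "kind x = Supporting"
          using low[of x] w' that height_child[OF w(1)] height_child[OF that(1)]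
          by (force simp: covered_def)
        then show ?thesis using h that by auto
      qed
      obtain x y where xy: "x \<noteq> y" "adj w x" "adj w y" "covered U x" "covered U y"
        using nbrs[of w] w v w' childrenD(1)[OF w(1)] by (auto simp: covered_def)
      then have "covered U v"
        using only childrenD(3)[OF w(1)] childrenD(3) by (metis adj_iff_children)
      then show ?thesis using v by (auto simp: covered_def)
    next
      assume neutral: "\<forall>w\<in>children v. kind w = Neutral"
      have child: "\<not> covered U x" if "x \<in> children v" for x
        using low[of x] v that neutral height_child[of x v] by (force simp: covered_def)
      show ?thesis
      proof (rule ccontr)
        assume "v \<notin> U"
        then obtain x y where "x \<noteq> y" "adj v x" "adj v y" "covered U x" "covered U y"
          using nbrs[of v] v less.prems by (auto simp: covered_def)
        then show False using child childrenD(3) by (metis adj_iff_children)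
      qed
    qed
  qed
  ultimately show ?case by blast
qed

end

section \<open>An optimal swap set\<close>

text \<open>The content of weakness for a tree rooted at a leaf: since \<open>r\<close> is a leaf at
  \<open>s\<close>, no child of \<open>s\<close> may be a leaf.\<close>

locale leaf_rooted_tree = rooted_tree +
  fixes s :: 'a
  assumes children_root: "children r = {s}"
    and leaf_child_unique: "w \<in> children v \<Longrightarrow> w' \<in> children v \<Longrightarrow>
      children w = {} \<Longrightarrow> children w' = {} \<Longrightarrow> w = w'"
    and no_leaf_child: "w \<in> children s \<Longrightarrow> children w \<noteq> {}"
begin

section \<open>Top-down choice of the matching\<close>

text \<open>The children to which \<open>v\<close> may be matched if it is not matched upwards. A
  leaf child takes precedence because leaves have to be matched. A demanding \<open>v\<close> takes
  a needy or neutral child, never a supporting one, which is matched downwards.\<close>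

definition candidates :: "'a \<Rightarrow> 'a set" where
  "candidates v = (if v = r then children r else case kind v of
      Supporting \<Rightarrow>
        if \<exists>w\<in>children v. children w = {} then {w \<in> children v. children w = {}}
        else {w \<in> children v. kind w = Demanding}
    | Demanding \<Rightarrow>
        if \<exists>w\<in>children v. kind w = Needy then {w \<in> children v. kind w = Needy}
        else children v
    | _ \<Rightarrow> {})"

definition pick :: "'a \<Rightarrow> 'a" where
  "pick v = (SOME w. w \<in> candidates v)"

text \<open>Membership in \<open>candidates (par v)\<close> guards against the arbitrary value of
  \<open>pick\<close> on an empty set.\<close>

function matched_up :: "'a \<Rightarrow> bool" where
  "matched_up v =
    (if v \<in> V \<and> v \<noteq> r
     then \<not> matched_up (par v) \<and> v \<in> candidates (par v) \<and> v = pick (par v) else False)"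
  by auto
termination by (relation "measure depth") (auto simp: depth_par)

declare matched_up.simps [simp del]

definition special :: "'a \<Rightarrow> 'a" where
  "special v = (SOME w. w \<in> children v \<and> kind w = Supporting)"

text \<open>
  An unmatched vertex inherits the colour of its parent, so that recolouring one supporting child
  gives it neighbours of both colours.
\<close>

function colour :: "'a \<Rightarrow> bool" where
  "colour v =
    (if v \<in> V \<and> v \<noteq> r
     then colour (par v) \<noteq> (matched_up v \<or> kind v = Supporting \<and> v = special (par v)) else True)"
  by auto
termination by (relation "measure depth") (auto simp: depth_par)

declare colour.simps [simp del]

lemma kind_leaf: "children v = {} \<Longrightarrow> kind v = Demanding"
  by (subst kind_unfold) (simp add: Let_def)

lemma candidates_subset: "w \<in> candidates v \<Longrightarrow> w \<in> children v"
  by (auto simp: candidates_def split: if_splits kind.splits)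

lemma candidates_kind:
  assumes "v \<noteq> r" "w \<in> candidates v"
  shows "kind v = Supporting \<and> kind w = Demanding \<or>
    kind v = Demanding \<and> (kind w = Needy \<or> kind w = Neutral)"
  using assms kind_leaf kind_DemandingD[of v]
  by (auto simp: candidates_def split: if_splits kind.splits)

lemma candidates_nonempty:
  assumes "v = r \<or> kind v = Supporting \<or> kind v = Demanding \<and> children v \<noteq> {}"
  shows "pick v \<in> candidates v"
proof -
  consider "v = r" | "v \<noteq> r" "kind v = Supporting" | "v \<noteq> r" "kind v = Demanding" "children v \<noteq> {}"
    using assms by blast
  then have "candidates v \<noteq> {}"
  proof cases
    case 2
    then show ?thesis using kind_Supporting_iff[of v] by (auto simp: candidates_def)
  qed (auto simp: candidates_def children_root)
  then show ?thesis unfolding pick_def by (simp add: some_in_eq)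
qed

lemma matched_upD:
  assumes "matched_up v"
  shows "v \<in> V" "v \<noteq> r" "\<not> matched_up (par v)" "v \<in> candidates (par v)" "pick (par v) = v"
  using assms by (simp_all add: matched_up.simps[of v] split: if_splits)

lemma matched_up_pick: "v \<in> V \<Longrightarrow> \<not> matched_up v \<Longrightarrow> pick v \<in> candidates v \<Longrightarrow> matched_up (pick v)"
  using childrenD[OF candidates_subset, of "pick v" v]
  by (subst matched_up.simps) simp

lemma not_matched_up_root: "\<not> matched_up r"
  using matched_upD by blast

lemma matched_up_s: "matched_up s"
proof -
  have "pick r \<in> candidates r" by (rule candidates_nonempty) simp
  then have "pick r = s" using candidates_subset children_root by blast
  then show ?thesis
    using matched_up_pick[OF root_in not_matched_up_root] \<open>pick r \<in> candidates r\<close> by simp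
qed

text \<open>The parent of a leaf other than \<open>s\<close> is supporting. It is not
  \<open>s\<close>, and no other supporting vertex is matched up; by weakness the leaf is then its
  only candidate.\<close>

lemma matched_up_leaf:
  assumes "v \<in> V" "v \<noteq> r" "children v = {}"
  shows "matched_up v"
proof (cases "par v = r")
  case True
  then have "v = s" using assms children_root in_children_par by blast
  then show ?thesis using matched_up_s by simp
next
  case False
  let ?p = "par v"
  have p: "?p \<in> V" "v \<in> children ?p" using assms par_in in_children_par by auto
  have supp: "kind ?p = Supporting" using p kind_leaf assms kind_Supporting_iff by blast
  have "\<not> matched_up ?p"
  proof
    assume up: "matched_up ?p"
    show False
    proof (cases "par ?p = r")
      case True
      then have "?p = s" using p False children_root in_children_par by blast
      then show False using no_leaf_child p assms by metis
    next
      case False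
      then show False using candidates_kind[OF False matched_upD(4)[OF up]] supp by auto
    qed
  qed
  moreover have "pick ?p \<in> candidates ?p" using supp candidates_nonempty by blast
  moreover have "candidates ?p = {v}"
    using supp False p assms leaf_child_unique by (auto simp: candidates_def)
  ultimately show ?thesis using matched_up_pick[OF p(1)] by auto
qed

section \<open>Counting the matching edges\<close>

definition up_edges :: "'a set" where
  "up_edges = {v \<in> V. matched_up v}"

lemma in_up_edges_iff: "v \<in> up_edges \<longleftrightarrow> matched_up v"
  using matched_upD(1) by (auto simp: up_edges_def)

lemma finite_up_edges: "finite up_edges"
  using finite_V by (simp add: up_edges_def)

text \<open>The matching attains \<open>min_edges\<close>, except for one extra edge at a demanding
  vertex that is not matched upwards.\<close>

lemma up_edges_subtree:
  assumes "v \<in> V" "v \<noteq> r"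
  shows "(\<Sum>w\<in>children v. card (up_edges \<inter> subtree w))
    = min_edges v + of_bool (kind v = Demanding \<and> \<not> matched_up v)"
  using assms
proof (induction v rule: children_induct)
  case (children v)
  \<comment> \<open>A demanding child contributes exactly one edge beyond its minimum: its upward
    edge, or by induction one below. So only matched-up children that are not demanding create a
    surplus, and \<open>pick v\<close> is the sole possibility.\<close>
  have "card (up_edges \<inter> subtree w) = (min_edges w + of_bool (kind w = Demanding))
      + of_bool (matched_up w \<and> kind w \<noteq> Demanding)" if "w \<in> children v" for w
    using card_Int_subtree[OF finite_up_edges, of w] children.IH[OF that] childrenD[OF that]
    by (auto simp: in_up_edges_iff)
  then have "(\<Sum>w\<in>children v. card (up_edges \<inter> subtree w))
    = min_edges v + (\<Sum>w\<in>children v. of_bool (matched_up w \<and> kind w \<noteq> Demanding))"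
    by (subst min_edges.simps) (simp add: sum.distrib)
  also have "(\<Sum>w\<in>children v. of_bool (matched_up w \<and> kind w \<noteq> Demanding))
    = card {w \<in> children v. matched_up w \<and> kind w \<noteq> Demanding}"
    by (simp add: Int_def)
  also have "\<dots> = of_bool (kind v = Demanding \<and> \<not> matched_up v)"
  proof (cases "kind v = Demanding \<and> \<not> matched_up v")
    case True
    then have "pick v \<in> candidates v"
      using matched_up_leaf children.prems children.hyps by (intro candidates_nonempty) blast
    then have "{w \<in> children v. matched_up w \<and> kind w \<noteq> Demanding} = {pick v}"
      using True matched_up_pick candidates_subset candidates_kind matched_upD childrenD
        children.prems children.hyps by fastforce
    then show ?thesis using True by simp
  next
    case False
    then have none: "{w \<in> children v. matched_up w \<and> kind w \<noteq> Demanding} = {}"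
      using candidates_kind[OF children.prems] matched_upD(3,4) childrenD(3) by fastforce
    show ?thesis using False unfolding none by auto
  qed
  finally show ?case .
qed

text \<open>The additional edge joins \<open>s\<close> to \<open>r\<close>; since \<open>s\<close>
  is matched up, there is no surplus below it.\<close>

lemma card_up_edges: "card up_edges = min_edges s + 1"
proof -
  have s: "s \<in> V" "s \<noteq> r" using children_root childrenD by blast+
  have "card up_edges = card (up_edges \<inter> subtree r)"
    by (auto simp: subtree_root up_edges_def intro: arg_cong[where f = card])
  also have "\<dots> = card (up_edges \<inter> subtree s)"
    using card_Int_subtree[OF finite_up_edges, of r]
    by (simp add: children_root in_up_edges_iff not_matched_up_root)
  also have "\<dots> = min_edges s + 1"
    using card_Int_subtree[OF finite_up_edges, of s] up_edges_subtree[OF s] matched_up_s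
    by (simp add: in_up_edges_iff)
  finally show ?thesis .
qed

section \<open>Colour classes as the two sides of the swap\<close>

abbreviation matched :: "'a \<Rightarrow> bool" where
  "matched \<equiv> covered up_edges"

definition partner :: "'a \<Rightarrow> 'a" where
  "partner v = (if matched_up v then par v else pick v)"

lemma matched_iff: "matched v \<longleftrightarrow> matched_up v \<or> (\<exists>w\<in>children v. matched_up w)"
  by (simp add: covered_def in_up_edges_iff)

lemma matched_down:
  assumes "matched v" "\<not> matched_up v"
  shows "matched_up (pick v)" "pick v \<in> children v"
proof -
  obtain w where w: "w \<in> children v" "matched_up w" using assms by (auto simp: matched_iff)
  then have "pick v = w" using matched_upD(5) childrenD(3) by blast
  then show "matched_up (pick v)" "pick v \<in> children v" using w by auto
qed

lemma matched_if_pick: "v \<in> V \<Longrightarrow> pick v \<in> candidates v \<Longrightarrow> matched v"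
  using matched_up_pick candidates_subset by (auto simp: matched_iff)

lemma partner_props:
  assumes "matched v"
  shows "matched (partner v)" "partner (partner v) = v" "adj v (partner v)"
    "colour (partner v) \<noteq> colour v"
proof -
  have "matched (partner v) \<and> partner (partner v) = v \<and> adj v (partner v) \<and>
    colour (partner v) \<noteq> colour v"
  proof (cases "matched_up v")
    case True
    note v = matched_upD[OF True]
    show ?thesis
      using v True in_children_par[OF v(1,2)] colour.simps[of v] adj_par
      by (auto simp: partner_def matched_iff)
  next
    case False
    note w = matched_down[OF assms False]
    show ?thesis
      using w False childrenD[OF w(2)] colour.simps[of "pick v"]
      by (auto simp: partner_def matched_iff adj_iff_children)
  qed
  then show "matched (partner v)" "partner (partner v) = v" "adj v (partner v)"
    "colour (partner v) \<noteq> colour v" by auto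
qed

text \<open>An unmatched vertex is neutral or needy. Its special child has the other colour; its own
  colour appears at a second supporting child or, if it is needy, at its parent.\<close>

lemma unmatched_neighbours:
  assumes "v \<in> V" "\<not> matched v"
  shows "\<exists>x. adj v x \<and> matched x \<and> colour x = c"
proof -
  have up: "\<not> matched_up v" using assms by (simp add: matched_iff)
  have "v \<noteq> r" using assms matched_up_s children_root by (auto simp: matched_iff)
  have no_pick: "pick v \<notin> candidates v" using matched_if_pick assms by blast
  then have kind: "kind v = Neutral \<or> kind v = Needy"
    using candidates_nonempty matched_up_leaf assms up \<open>v \<noteq> r\<close> by (cases "kind v") auto
  have helper: "adj v h" "matched h" "colour h = (colour v \<noteq> (h = special v))"
    if "h \<in> children v" "kind h = Supporting" for h
  proof -
    note h = childrenD[OF that(1)]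
    have "\<not> matched_up h"
      using that assms(2) by (auto simp: matched_iff)
    then show "colour h = (colour v \<noteq> (h = special v))"
      using h that by (subst colour.simps) auto
    show "matched h" using candidates_nonempty[of h] that h matched_if_pick by blast
  qed (use that in \<open>simp add: adj_iff_children\<close>)
  have spec: "special v \<in> children v" "kind (special v) = Supporting"
    using kind kind_NeedyD kind_NeutralD someI_ex[of "\<lambda>w. w \<in> children v \<and> kind w = Supporting"]
    unfolding special_def by metis+
  have "\<exists>x. adj v x \<and> matched x \<and> colour x = (\<not> colour v)"
    using helper[OF spec] by auto
  moreover have "\<exists>x. adj v x \<and> matched x \<and> colour x = colour v"
    using kind
  proof
    assume "kind v = Neutral"
    then obtain h where "h \<in> children v" "kind h = Supporting" "h \<noteq> special v"
      by (metis kind_NeutralD)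
    then show ?thesis using helper[of h] by auto
  next
    assume needy: "kind v = Needy"
    \<comment> \<open>A parent of a needy vertex is supporting or demanding, hence has a candidate
      and is matched.\<close>
    have "pick (par v) \<in> candidates (par v)"
      using kind_child_Needy[OF in_children_par needy] assms \<open>v \<noteq> r\<close> in_children_par
      by (intro candidates_nonempty) blast
    then have "matched (par v)" using matched_if_pick par_in assms \<open>v \<noteq> r\<close> by blast
    moreover have "colour (par v) = colour v"
      using colour.simps[of v] needy up assms \<open>v \<noteq> r\<close> by simp
    ultimately show ?thesis using adj_par assms \<open>v \<noteq> r\<close> by blast
  qed
  ultimately show ?thesis by (cases "c = colour v") auto
qed

definition colour_class :: "bool \<Rightarrow> 'a set" where
  "colour_class c = {v \<in> V. matched v \<and> colour v = c}"

lemma colour_class_dominating: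
  assumes "v \<in> V" "v \<notin> colour_class c"
  shows "\<exists>u\<in>colour_class c. adj u v"
proof (cases "matched v")
  case True
  then have "partner v \<in> colour_class c" "adj (partner v) v"
    using partner_props[OF True] assms by (auto simp: colour_class_def adj_iff)
  then show ?thesis by blast
next
  case False
  then obtain x where "adj v x" "matched x" "colour x = c"
    using unmatched_neighbours assms by blast
  then show ?thesis by (auto simp: colour_class_def adj_iff)
qed

lemma partner_bij: "bij_betw partner (colour_class True) (colour_class False)"
  by (rule bij_betw_byWitness[where f' = partner])
    (use partner_props in \<open>fastforce simp: colour_class_def adj_iff\<close>)+

text \<open>Each vertex of the class is sent to its matching edge, given by the lower end. This is
  injective because the ends of an edge have different colours.\<close>

lemma card_colour_class: "card (colour_class c) \<le> min_edges s + 1"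
proof -
  let ?e = "\<lambda>v. if matched_up v then v else pick v"
  have "inj_on ?e (colour_class c)"
  proof (rule inj_onI)
    fix x y assume xy: "x \<in> colour_class c" "y \<in> colour_class c" "?e x = ?e y"
    then have m: "matched x" "matched y" "colour x = colour y" by (auto simp: colour_class_def)
    have down: "\<not> matched_up u \<Longrightarrow> matched u \<Longrightarrow> par (pick u) = u" for u
      using matched_down(2) childrenD(3) by blast
    have "x = y \<or> x = partner y \<or> y = partner x"
    proof (cases "matched_up x"; cases "matched_up y")
      assume *: "\<not> matched_up x" "\<not> matched_up y"
      then have "pick x = pick y" using xy(3) by simp
      then show ?thesis using * down m by metis
    qed (use xy(3) in \<open>simp_all add: partner_def\<close>)
    then show "x = y" using m partner_props(4)[OF m(1)] partner_props(4)[OF m(2)] by auto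
  qed
  moreover have "?e ` colour_class c \<subseteq> up_edges"
    using matched_down(1) by (auto simp: colour_class_def in_up_edges_iff)
  ultimately have "card (colour_class c) \<le> card up_edges"
    using finite_up_edges card_inj_on_le by blast
  then show ?thesis by (simp add: card_up_edges)
qed

end

section \<open>Rooting an undirected tree\<close>

context graph
begin

lemma adj_sym: "u \<rightarrow> v \<Longrightarrow> v \<rightarrow> u"
  using arcs_ends_symmetric[OF sym_arcs] .

lemma symmetric_del_vert: "symmetric (del_vert v)"
  using sym_arcs by (fastforce simp: symmetric_conv del_vert_simps)

lemma reachable_del_vertI:
  assumes "awalk x p y" "v \<notin> set (awalk_verts x p)"
  shows "x \<rightarrow>\<^sup>*\<^bsub>del_vert v\<^esub> y"
  using assms
proof (induction p arbitrary: x)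
  case Nil
  interpret H: wf_digraph "del_vert v" by (rule wf_digraph_del_vert)
  show ?case using Nil by (auto simp: awalk_Nil_iff verts_del_vert)
next
  case (Cons e p)
  interpret H: wf_digraph "del_vert v" by (rule wf_digraph_del_vert)
  have e: "e \<in> arcs G" "tail G e = x" "awalk (head G e) p y"
    using Cons.prems by (auto simp: awalk_Cons_iff)
  have "head G e \<in> set (awalk_verts (head G e) p)"
    using e(3) by (rule hd_in_awalk_verts)
  then have "x \<rightarrow>\<^bsub>del_vert v\<^esub> head G e"
    using e Cons.prems(2) by (auto simp: arcs_ends_conv del_vert_simps intro!: image_eqI[of _ _ e])
  moreover have "head G e \<rightarrow>\<^sup>*\<^bsub>del_vert v\<^esub> y"
    using Cons.IH e(3) Cons.prems(2) by simp
  ultimately show ?case by (rule H.adj_reachable_trans)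
qed

text \<open>Otherwise a path from \<open>a\<close> to \<open>b\<close> that avoids \<open>v\<close>
  would close up through \<open>v\<close> to a cycle. This makes parents unique.\<close>

lemma reachable_neighbours_eq:
  assumes acyclic: "\<not> (\<exists>p. cycle p \<and> 3 \<le> length p)"
    and "v \<rightarrow> a" "v \<rightarrow> b" "a \<rightarrow>\<^sup>*\<^bsub>del_vert v\<^esub> b"
  shows "a = b"
proof (rule ccontr)
  assume "a \<noteq> b"
  interpret H: wf_digraph "del_vert v" by (rule wf_digraph_del_vert)
  obtain p where p: "H.apath a p b" using assms(4) H.reachable_apath by blast
  have path: "apath a p b"
    using subgraph_apath_imp_apath[OF p subgraph_del_vert] .
  have "awalk_verts a p = H.awalk_verts a p"
    by (induction p arbitrary: a) (auto simp: del_vert_simps)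
  moreover have "set (H.awalk_verts a p) \<subseteq> verts (del_vert v)"
    using p by (auto simp: H.apath_def)
  ultimately have v: "v \<notin> set (awalk_verts a p)" by (auto simp: verts_del_vert)
  obtain e where e: "e \<in> arcs G" "tail G e = v" "head G e = a" using assms(2) by auto
  obtain e' where e': "e' \<in> arcs G" "tail G e' = b" "head G e' = v"
    using adj_sym[OF assms(3)] by auto
  have "p \<noteq> []" using path \<open>a \<noteq> b\<close> by (auto simp: apath_Nil_iff)
  have ap: "awalk a p b" "distinct (awalk_verts a p)" using path by (auto simp: apath_def)
  have "awalk b [e'] v" using e' by (auto simp: awalk_simps)
  then have walk: "awalk a (p @ [e']) v" using ap awalk_appendI by blast
  have "awalk_verts a (p @ [e']) = awalk_verts a p @ [v]"
    using awalk_verts_append[OF walk] e' by simp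
  then have "cycle (e # p @ [e'])"
    unfolding cycle_def using walk e ap v by (intro exI[of _ v]) (auto simp: awalk_Cons_iff)
  moreover have "3 \<le> length (e # p @ [e'])" using \<open>p \<noteq> []\<close> by (cases p) auto
  ultimately show False using acyclic by blast
qed

text \<open>The parent of \<open>v\<close> is the neighbour that \<open>r\<close> reaches without
  passing through \<open>v\<close>. A shortest walk from \<open>r\<close> shows existence,
  acyclicity uniqueness.\<close>

lemma undirected_tree_rooted:
  assumes "undirected_tree G" "r \<in> verts G"
  shows "\<exists>par depth. rooted_tree (verts G) (dominates G) r par depth"
proof -
  have acyclic: "\<not> (\<exists>p. cycle p \<and> 3 \<le> length p)"
    using assms by (simp add: undirected_tree_def)
  have reach: "r \<rightarrow>\<^sup>* v" if "v \<in> verts G" for v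
  proof -
    have "r \<rightarrow>\<^sup>*\<^bsub>mk_symmetric G\<^esub> v"
      using assms that by (auto simp: undirected_tree_def connected_def strongly_connected_def)
    then show ?thesis using reachable_mk_symmetric_eq[OF sym_arcs] by simp
  qed
  define toward where "toward v w \<longleftrightarrow> v \<rightarrow> w \<and> r \<rightarrow>\<^sup>*\<^bsub>del_vert v\<^esub> w" for v w
  define depth where "depth v = (LEAST n. \<exists>p. awalk r p v \<and> length p = n)" for v
  have depth_le: "depth v \<le> length p" if "awalk r p v" for p v
    unfolding depth_def using that by (intro Least_le) auto
  have toward_unique: "w = w'" if "toward v w" "toward v w'" for v w w'
  proof -
    interpret H: wf_digraph "del_vert v" by (rule wf_digraph_del_vert)
    have "w \<rightarrow>\<^sup>*\<^bsub>del_vert v\<^esub> w'"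
      using that symmetric_reachable[OF symmetric_del_vert] H.reachable_trans
      unfolding toward_def by blast
    then show ?thesis
      using reachable_neighbours_eq[OF acyclic] that by (auto simp: toward_def)
  qed
  have toward_ex: "\<exists>w. toward v w \<and> depth w < depth v" if "v \<in> verts G" "v \<noteq> r" for v
  proof -
    have "\<exists>n p. awalk r p v \<and> length p = n" using reach[OF that(1)] by (auto simp: reachable_awalk)
    then have "\<exists>p. awalk r p v \<and> length p = depth v"
      unfolding depth_def by (rule LeastI_ex)
    then obtain p where p: "awalk r p v" "length p = depth v" by blast
    have "p \<noteq> []" using p that by (auto simp: awalk_Nil_iff)
    then obtain q e where pq: "p = q @ [e]" by (metis append_butlast_last_id)
    let ?w = "awlast r q"
    have q: "awalk r q ?w" and e: "e \<in> arcs G" "tail G e = ?w" "head G e = v"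
      using p(1) by (auto simp: pq awalk_simps)
    \<comment> \<open>An earlier visit to \<open>v\<close> would give a walk shorter than
      \<open>depth v\<close>.\<close>
    have "v \<notin> set (awalk_verts r q)"
    proof
      assume "v \<in> set (awalk_verts r q)"
      then obtain q1 q2 where "q = q1 @ q2" "awalk r q1 v" using awalk_decomp[OF q] by blast
      then show False using depth_le[of q1 v] p(2) pq by simp
    qed
    then have "r \<rightarrow>\<^sup>*\<^bsub>del_vert v\<^esub> ?w" using reachable_del_vertI q by blast
    moreover have "v \<rightarrow> ?w" using e in_arcs_imp_in_arcs_ends[of e] adj_sym by metis
    moreover have "depth ?w < depth v" using depth_le[OF q] p(2) pq by simp
    ultimately show ?thesis by (auto simp: toward_def)
  qed
  define par where "par v = (SOME w. toward v w)" for v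
  have par: "toward v (par v)" if "v \<in> verts G" "v \<noteq> r" for v
    unfolding par_def using toward_ex[OF that] by (blast intro: someI_ex)
  have par_eq: "par v = w" if "v \<in> verts G" "v \<noteq> r" "toward v w" for v w
    using par toward_unique that by blast
  have "rooted_tree (verts G) (dominates G) r par depth"
  proof
    fix x y
    show "x \<rightarrow> y \<longleftrightarrow> x \<in> verts G \<and> y \<in> verts G \<and> (x \<noteq> r \<and> par x = y \<or> y \<noteq> r \<and> par y = x)"
    proof
      assume xy: "x \<rightarrow> y"
      then have V: "x \<in> verts G" "y \<in> verts G" by (auto dest: adj_in_verts)
      have "x \<noteq> y" using xy adj_not_same by blast
      \<comment> \<open>If this path misses \<open>y\<close>, then \<open>x\<close> is the parent of
        \<open>y\<close>; if it passes through \<open>y\<close>, its initial piece up to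
        \<open>y\<close> avoids \<open>x\<close>, so \<open>y\<close> is the parent of
        \<open>x\<close>.\<close>
      obtain p where p: "apath r p x" using reach[OF V(1)] reachable_apath by blast
      then have walk: "awalk r p x" "distinct (awalk_verts r p)" by (auto simp: apath_def)
      have "x \<noteq> r \<and> toward x y \<or> y \<noteq> r \<and> toward y x"
      proof (cases "y \<in> set (awalk_verts r p)")
        case False
        then have "y \<noteq> r" using hd_in_awalk_verts(1)[OF walk(1)] by auto
        then show ?thesis
          using False reachable_del_vertI[OF walk(1)] adj_sym[OF xy] by (auto simp: toward_def)
      next
        case True
        then obtain q q' where q: "p = q @ q'" "awalk r q y" "awalk y q' x"
          using awalk_decomp[OF walk(1)] by blast
        have "q' \<noteq> []" using q(3) \<open>x \<noteq> y\<close> by (auto simp: awalk_Nil_iff)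
        have "awlast y q' = x" using q(3) by auto
        then have "x \<in> set (tl (awalk_verts y q'))"
          using \<open>q' \<noteq> []\<close> by (cases q') (auto dest: last_in_set)
        moreover have "set (awalk_verts r q) \<inter> set (tl (awalk_verts y q')) = {}"
          using p q awlast_of_awalk[OF q(2)] by (simp add: apath_append_iff)
        ultimately have "x \<notin> set (awalk_verts r q)" by blast
        moreover from this have "x \<noteq> r" using hd_in_awalk_verts(1)[OF q(2)] by auto
        ultimately show ?thesis
          using reachable_del_vertI[OF q(2)] xy by (auto simp: toward_def)
      qed
      then show "x \<in> verts G \<and> y \<in> verts G \<and> (x \<noteq> r \<and> par x = y \<or> y \<noteq> r \<and> par y = x)"
        using V par_eq by blast
    next
      assume "x \<in> verts G \<and> y \<in> verts G \<and> (x \<noteq> r \<and> par x = y \<or> y \<noteq> r \<and> par y = x)"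
      then show "x \<rightarrow> y" using par adj_sym by (auto simp: toward_def)
    qed
  next
    fix v assume v: "v \<in> verts G" "v \<noteq> r"
    show "par v \<in> verts G" using par[OF v] adj_in_verts by (auto simp: toward_def)
    show "depth (par v) < depth v" using toward_ex[OF v] par_eq[OF v] by auto
  qed (use assms in auto)
  then show ?thesis by blast
qed

section \<open>Degrees and induced subgraphs\<close>

lemma out_degree_eq_card: "out_degree G v = card {w. v \<rightarrow> w}"
proof -
  have "bij_betw (head G) (out_arcs G v) {w. v \<rightarrow> w}"
    by (auto simp: bij_betw_def inj_on_def arcs_ends_conv arc_to_ends_def intro: no_multi_arcs)
  then show ?thesis by (simp add: out_degree_def bij_betw_same_card)
qed

lemma arcs_ends_induce: "arcs_ends (G \<restriction> A) = arcs_ends G \<inter> A \<times> A"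
  by (auto simp: arcs_ends_conv)

lemma graph_induce: "A \<subseteq> verts G \<Longrightarrow> graph (G \<restriction> A)"
proof -
  assume "A \<subseteq> verts G"
  moreover have "symmetric (G \<restriction> A)"
    using adj_sym by (auto simp: symmetric_def arcs_ends_induce intro: symI)
  ultimately show ?thesis
    using finite_subset[of A "verts G"] no_loops no_multi_arcs
    by unfold_locales (auto simp: arc_to_ends_def)
qed

end

section \<open>Comparing the three parameters\<close>

lemma dominating_setI:
  assumes "D \<subseteq> verts G" "\<And>v. v \<in> verts G \<Longrightarrow> v \<notin> D \<Longrightarrow> \<exists>u\<in>D. u \<rightarrow>\<^bsub>G\<^esub> v"
  shows "dominating_set G D"
  using assms by (auto simp: dominating_set_def)

lemma dominating_setD:
  assumes "dominating_set G D"
  shows "D \<subseteq> verts G" "v \<in> verts G \<Longrightarrow> v \<notin> D \<Longrightarrow> \<exists>u\<in>D. u \<rightarrow>\<^bsub>G\<^esub> v"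
  using assms by (auto simp: dominating_set_def)

text \<open>All guards cross the matching at once; as the two sides are disjoint, this vacates every
  attacked vertex.\<close>

lemma (in graph) swap_set_eviction_family:
  assumes "swap_set G D"
  shows "\<exists>F. eviction_family G (card D) F"
proof -
  obtain D' f where D': "dominating_set G D" "dominating_set G D'" "D \<inter> D' = {}" "card D = card D'"
    and f: "bij_betw f D D'" "\<forall>x\<in>D. x \<rightarrow> f x"
    using assms by (auto simp: swap_set_def)
  let ?g = "inv_into D f"
  have g: "bij_betw ?g D' D" using f(1) by (rule bij_betw_inv_into)
  have g': "y \<rightarrow> ?g y" if "y \<in> D'" for y
  proof -
    have "?g y \<in> D" "f (?g y) = y"
      using that f(1) by (auto simp: bij_betw_def inv_into_into f_inv_into_f)
    then show ?thesis using f(2) adj_sym by metis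
  qed
  have fwd: "\<exists>h. bij_betw h D D' \<and> (\<forall>x\<in>D. h x \<in> closed_neighbourhood G x)"
    using f by (auto simp: closed_neighbourhood_def)
  have bwd: "\<exists>h. bij_betw h D' D \<and> (\<forall>x\<in>D'. h x \<in> closed_neighbourhood G x)"
    using g g' by (auto simp: closed_neighbourhood_def)
  have "eviction_family G (card D) {D, D'}"
    unfolding eviction_family_def
  proof (intro conjI ballI)
    fix C v assume C: "C \<in> {D, D'}" "v \<in> C"
    show "\<exists>C'\<in>{D, D'}. v \<notin> C' \<and>
      (\<exists>h. bij_betw h C C' \<and> (\<forall>x\<in>C. h x \<in> closed_neighbourhood G x))"
    proof (cases "C = D")
      case True
      then show ?thesis using C D'(3) fwd by (intro bexI[of _ D']) auto
    next
      case False
      then show ?thesis using C D'(3) bwd by (intro bexI[of _ D]) auto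
    qed
  qed (use D' in auto)
  then show ?thesis by blast
qed

locale rooted_tree_graph = graph G + rooted_tree "verts G" "dominates G" r par depth
  for G :: "('a, 'b) pre_digraph" (structure) and r par depth
begin

lemma leaf_iff_no_children: "v \<in> verts G \<Longrightarrow> v \<noteq> r \<Longrightarrow> leaf G v \<longleftrightarrow> children v = {}"
proof -
  assume v: "v \<in> verts G" "v \<noteq> r"
  then have "{w. v \<rightarrow> w} = insert (par v) (children v)"
    using in_children_par childrenD(3) by (auto simp: adj_iff_children)
  moreover have "par v \<notin> children v"
    using v childrenD(5)[of v "par v"] childrenD(5)[of "par v" v] in_children_par by fastforce
  ultimately show ?thesis using v by (simp add: leaf_def out_degree_eq_card)
qed

text \<open>The parts are the matching edges and the remaining single vertices, so each member of
  \<open>D\<close> contributes weight one.\<close>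

lemma star_partitioning_of_swap_set:
  assumes "swap_set G D"
  shows "\<exists>P. simple_star_partitioning G P \<and> partition_weight P = card D"
proof -
  obtain D' f where D: "dominating_set G D" and D': "dominating_set G D'" and disj: "D \<inter> D' = {}"
    and f: "bij_betw f D D'" "\<And>x. x \<in> D \<Longrightarrow> x \<rightarrow> f x"
    using assms by (auto simp: swap_set_def)
  have sub: "D \<subseteq> verts G" "D' \<subseteq> verts G" using D D' by (auto dest: dominating_setD)
  have "f x \<in> D' \<and> f x \<notin> D" if "x \<in> D" for x
    using that f(1) disj by (auto simp: bij_betw_def)
  then have fD: "f x \<in> D'" "f x \<notin> D" "f x \<noteq> x" if "x \<in> D" for x
    using that by metis+
  have inj: "x = y" if "x \<in> D" "y \<in> D" "f x = f y" for x y
    using that f(1) by (auto simp: bij_betw_def inj_on_def)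
  have surj: "\<exists>x\<in>D. y = f x" if "y \<in> D'" for y
    using that f(1) by (auto simp: bij_betw_def)
  define e where "e x = {x, f x}" for x
  define R where "R = verts G - D - D'"
  define P where "P = e ` D \<union> (\<lambda>x. {x}) ` R"
  have fin: "finite D" "finite R" using finite_subset[OF sub(1) finite_verts] by (auto simp: R_def)
  have e_Int: "e x \<inter> D = {x}" if "x \<in> D" for x using fD that by (auto simp: e_def)
  have card_e: "card (e x) = 2" if "x \<in> D" for x using fD(3)[OF that] by (auto simp: e_def)
  have "partition_on (verts G) P"
  proof (rule partition_onI)
    have "\<Union>P = D \<union> f ` D \<union> R" by (auto simp: P_def e_def)
    also have "f ` D = D'" using f(1) by (simp add: bij_betw_def)
    finally show "\<Union>P = verts G" using sub by (auto simp: R_def)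
    show "disjnt p q" if "p \<in> P" "q \<in> P" "p \<noteq> q" for p q
      using that fD inj by (auto simp: P_def e_def R_def disjnt_def)
    show "{} \<notin> P" by (auto simp: P_def e_def)
  qed
  moreover have "star_part G A" if A: "A \<in> P" for A
  proof -
    have gr: "graph (G \<restriction> A)"
      using that sub fD by (intro graph_induce) (auto simp: P_def e_def R_def)
    consider x where "x \<in> D" "A = e x" | x where "A = {x}"
      using A by (auto simp: P_def)
    then show ?thesis
    proof cases
      case 1
      then have "arcs_ends (G \<restriction> A) = {x} \<times> {f x} \<union> {f x} \<times> {x}"
        using f(2) adj_sym adj_not_same by (auto simp: arcs_ends_induce e_def)
      then have "K\<^bsub>1,1\<^esub> (G \<restriction> A)"
        unfolding complete_bipartite_digraph_def using gr 1 fD(3)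
        by (intro conjI exI[of _ "{x}"] exI[of _ "{f x}"]) (auto simp: e_def)
      then show ?thesis by (auto simp: star_part_def)
    next
      case 2
      then have "K\<^bsub>1\<^esub> (G \<restriction> A)"
        unfolding complete_digraph_def using gr adj_not_same by (auto simp: arcs_ends_induce)
      then show ?thesis by (simp add: star_part_def)
    qed
  qed
  moreover have "{v, l} \<in> P" if "leaf_neighbours G v = {l}" for v l
  proof -
    have "leaf G l" "v \<rightarrow> l" using that by (auto simp: leaf_neighbours_def)
    then have "card {w. l \<rightarrow> w} = 1" and l: "l \<in> verts G"
      by (auto simp: leaf_def out_degree_eq_card)
    then have only: "w = v" if "l \<rightarrow> w" for w
      using that adj_sym[OF \<open>v \<rightarrow> l\<close>] by (metis card_1_singletonE mem_Collect_eq singletonD)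
    \<comment> \<open>Otherwise the only neighbour of \<open>l\<close> would lie in both disjoint
      sets.\<close>
    have "l \<in> D \<union> D'"
    proof (rule ccontr)
      assume "l \<notin> D \<union> D'"
      then obtain u u' where "u \<in> D" "u \<rightarrow> l" "u' \<in> D'" "u' \<rightarrow> l"
        using dominating_setD(2)[OF D l] dominating_setD(2)[OF D' l] by blast
      then show False using only adj_sym disj by blast
    qed
    then have "\<exists>x\<in>D. {v, l} = e x"
    proof
      assume "l \<in> D"
      then show ?thesis using only f(2) by (intro bexI[of _ l]) (auto simp: e_def)
    next
      assume "l \<in> D'"
      then obtain x where x: "x \<in> D" "l = f x" using surj by blast
      then have "x = v" using only f(2) adj_sym by blast
      then show ?thesis using x by (intro bexI[of _ x]) (auto simp: e_def)
    qed
    then show ?thesis by (auto simp: P_def)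
  qed
  moreover have "2 \<le> card {B \<in> P. card B \<noteq> 1 \<and> parts_adjacent G A B}"
    if A: "A \<in> P" "card A = 1" for A
  proof -
    obtain v where v: "v \<in> R" "A = {v}" using A card_e by (force simp: P_def)
    then have vR: "v \<in> verts G" "v \<notin> D" "v \<notin> D'" by (auto simp: R_def)
    obtain x u' where x: "x \<in> D" "x \<rightarrow> v" and u': "u' \<in> D'" "u' \<rightarrow> v"
      using dominating_setD(2)[OF D vR(1,2)] dominating_setD(2)[OF D' vR(1,3)] by blast
    then obtain y where y: "y \<in> D" "f y \<rightarrow> v" using surj by blast
    \<comment> \<open>If \<open>x = y\<close>, then \<open>x\<close>, \<open>f x\<close> and
      \<open>v\<close> would form a triangle.\<close>
    have "x \<noteq> y" using adj_triangle_free[of x "f x" v] f(2)[OF x(1)] x y by auto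
    then have "e x \<noteq> e y" using e_Int x y by (metis singleton_inject)
    moreover have "{e x, e y} \<subseteq> {B \<in> P. card B \<noteq> 1 \<and> parts_adjacent G A B}"
      using x y card_e v adj_sym fD vR by (auto simp: P_def parts_adjacent_def e_def)
    moreover have "finite P" using fin by (simp add: P_def)
    ultimately show ?thesis using card_mono[of "{B \<in> P. card B \<noteq> 1 \<and> parts_adjacent G A B}" "{e x, e y}"]
      by auto
  qed
  ultimately have "simple_star_partitioning G P"
    by (simp add: simple_star_partitioning_def)
  moreover have "partition_weight P = card D"
  proof -
    have "e ` D \<inter> (\<lambda>x. {x}) ` R = {}" using card_e by force
    then have "partition_weight P = (\<Sum>A\<in>e ` D. card A - 1) + (\<Sum>A\<in>(\<lambda>x. {x}) ` R. card A - 1)"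
      unfolding partition_weight_def P_def using fin by (intro sum.union_disjoint) auto
    also have "(\<Sum>A\<in>(\<lambda>x. {x}) ` R. card A - 1) = 0" by (intro sum.neutral) auto
    also have "(\<Sum>A\<in>e ` D. card A - 1) = (\<Sum>x\<in>D. card (e x) - 1)"
      by (rule sum.reindex_cong[OF _ refl refl]) (metis e_Int inj_onI singleton_inject)
    also have "\<dots> = card D" using card_e by simp
    finally show ?thesis by simp
  qed
  ultimately show ?thesis by blast
qed

text \<open>The tree edges inside the parts satisfy the hypotheses of
  \<open>edge_cover_subtree_bound\<close>, and their number is at most the weight.\<close>

lemma star_partitioning_weight:
  assumes P: "simple_star_partitioning G P" and r: "children r = {s}" and pair: "{s, r} \<in> P"
  shows "min_edges s + 1 \<le> partition_weight P"
proof -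
  have part: "partition_on (verts G) P" and star: "\<And>A. A \<in> P \<Longrightarrow> star_part G A"
    and single: "\<And>A. A \<in> P \<Longrightarrow> card A = 1 \<Longrightarrow>
      2 \<le> card {B \<in> P. card B \<noteq> 1 \<and> parts_adjacent G A B}"
    using P by (auto simp: simple_star_partitioning_def)
  have subA: "A \<subseteq> verts G" if "A \<in> P" for A
    using that part by (auto simp: partition_on_def)
  then have finA: "finite A" if "A \<in> P" for A
    using that finite_verts finite_subset by metis
  have "finite P" using finite_elements[OF finite_verts part] .
  define U where "U = {w \<in> verts G. w \<noteq> r \<and> (\<exists>A\<in>P. w \<in> A \<and> par w \<in> A)}"
  have finU: "finite U" by (simp add: U_def)
  \<comment> \<open>In a star with at least two vertices, every vertex has a neighbour inside the
    part.\<close>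
  have cov: "covered U x" if A: "A \<in> P" "card A \<noteq> 1" "x \<in> A" for A x
  proof -
    have "star_part G A" "\<not> K\<^bsub>1\<^esub> (G \<restriction> A)"
      using star that by (auto simp: complete_digraph_def)
    then obtain n X Y where n: "1 \<le> n" "A = X \<union> Y" "card X = 1" "card Y = n"
      "arcs_ends (G \<restriction> A) = X \<times> Y \<union> Y \<times> X"
      by (auto simp: star_part_def complete_bipartite_digraph_def)
    then have "X \<noteq> {}" "Y \<noteq> {}" by auto
    then obtain y where "(x, y) \<in> arcs_ends (G \<restriction> A)" "y \<in> A" using n A(3) by fastforce
    then have "x \<rightarrow> y" by (auto simp: arcs_ends_induce)
    then consider "x \<in> children y" | "y \<in> children x" by (auto simp: adj_iff_children)
    then show ?thesis
    proof cases
      case 1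
      then have "x \<in> U" using A \<open>y \<in> A\<close> childrenD[OF 1] by (auto simp: U_def)
      then show ?thesis by (simp add: covered_def)
    next
      case 2
      then have "y \<in> U" using A \<open>y \<in> A\<close> childrenD[OF 2] by (auto simp: U_def)
      then show ?thesis using 2 by (auto simp: covered_def)
    qed
  qed
  have nbrs: "\<exists>x y. x \<noteq> y \<and> v \<rightarrow> x \<and> v \<rightarrow> y \<and> covered U x \<and> covered U y"
    if v: "v \<in> verts G" "\<not> covered U v" for v
  proof -
    obtain A where A: "A \<in> P" "v \<in> A" using part v(1) by (auto simp: partition_on_def)
    then have "card A = 1" using cov v(2) by blast
    then have Av: "A = {v}" using A(2) by (auto simp: card_1_singleton_iff)
    let ?S = "{B \<in> P. card B \<noteq> 1 \<and> parts_adjacent G A B}"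
    have "\<not> card ?S \<le> Suc 0" using single[OF A(1) \<open>card A = 1\<close>] by linarith
    then obtain B B' where B: "B \<in> ?S" "B' \<in> ?S" "B \<noteq> B'"
      using \<open>finite P\<close> by (auto simp: card_le_Suc0_iff_eq)
    then obtain x y where xy: "x \<in> B" "v \<rightarrow> x" "y \<in> B'" "v \<rightarrow> y"
      by (auto simp: parts_adjacent_def Av)
    have "B \<inter> B' = {}" using B part by (auto simp: partition_on_def disjoint_def)
    then have "x \<noteq> y" using xy by auto
    moreover have "covered U x" "covered U y" using B xy by (auto intro: cov)
    ultimately show ?thesis using xy by blast
  qed
  have s: "s \<in> verts G" "s \<noteq> r" "par s = r" using r childrenD by blast+
  have "U \<subseteq> verts G" by (auto simp: U_def)
  then have "card U = card (U \<inter> subtree r)" by (simp add: subtree_root Int_absorb2)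
  also have "\<dots> = card (U \<inter> subtree s)"
    using card_Int_subtree[OF finU, of r] by (simp add: r U_def)
  also have "\<dots> = 1 + (\<Sum>w\<in>children s. card (U \<inter> subtree w))"
    \<comment> \<open>The part \<open>{s, r}\<close> puts \<open>s\<close> into \<open>U\<close>,
      which accounts for the summand 1.\<close>
    using card_Int_subtree[OF finU, of s] s pair by (auto simp: U_def)
  finally have "min_edges s + 1 \<le> card U"
    using edge_cover_subtree_bound[OF finU nbrs s(1)] by simp
  also have "card U \<le> card (\<Union>A\<in>P. {w \<in> A. w \<noteq> r \<and> par w \<in> A})"
    using \<open>finite P\<close> finA by (intro card_mono) (auto simp: U_def)
  also have "\<dots> \<le> (\<Sum>A\<in>P. card {w \<in> A. w \<noteq> r \<and> par w \<in> A})"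
    by (rule card_UN_le[OF \<open>finite P\<close>])
  also have "\<dots> \<le> (\<Sum>A\<in>P. card A - 1)"
  proof (rule sum_mono)
    fix A assume A: "A \<in> P"
    then have "A \<noteq> {}" using part by (auto simp: partition_on_def)
    \<comment> \<open>The parent of a shallowest vertex of the part lies outside the part, so that
      vertex contributes no edge.\<close>
    then obtain x where x: "x \<in> A" "\<And>y. y \<in> A \<Longrightarrow> depth x \<le> depth y"
      using finA[OF A] by (metis arg_min_if_finite(1) arg_min_least)
    then have "{w \<in> A. w \<noteq> r \<and> par w \<in> A} \<subseteq> A - {x}"
      using depth_par[of x] subA[OF A] by (auto simp: not_le[symmetric])
    then have "card {w \<in> A. w \<noteq> r \<and> par w \<in> A} \<le> card (A - {x})"
      using finA[OF A] by (intro card_mono) auto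
    then show "card {w \<in> A. w \<noteq> r \<and> par w \<in> A} \<le> card A - 1" using x(1) finA[OF A] by simp
  qed
  finally show ?thesis by (simp add: partition_weight_def)
qed

text \<open>Only \<open>r\<close> and \<open>s\<close> can dominate \<open>r\<close>, so if
  \<open>r\<close> is empty, an attack on \<open>s\<close> forces a guard onto \<open>r\<close>.
  Such a guard lies outside the subtree at \<open>s\<close> and adds one to its bound.\<close>

lemma eviction_family_size:
  assumes F: "eviction_family G k F" and r: "children r = {s}"
  shows "min_edges s + 1 \<le> k"
proof -
  have dom: "\<And>D. D \<in> F \<Longrightarrow> dominating_set G D" and card: "\<And>D. D \<in> F \<Longrightarrow> card D = k"
    and evict: "\<And>D v. D \<in> F \<Longrightarrow> v \<in> D \<Longrightarrow> \<exists>D'\<in>F. v \<notin> D' \<and>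
      (\<exists>f. bij_betw f D D' \<and> (\<forall>x\<in>D. f x = x \<or> x \<rightarrow> f x))"
    using F by (auto simp: eviction_family_def closed_neighbourhood_def)
  have s: "s \<in> verts G" using r childrenD by blast
  have root: "r \<in> D \<or> s \<in> D" if "D \<in> F" for D
  proof (rule disjCI)
    assume "s \<notin> D"
    have "u = s" if "u \<rightarrow> r" for u
      using that r childrenD(2)[of r u] by (auto simp: adj_iff_children)
    then show "r \<in> D"
      using dominating_setD(2)[OF dom[OF that] root_in] \<open>s \<notin> D\<close> by blast
  qed
  obtain D0 where "D0 \<in> F" using F by (auto simp: eviction_family_def)
  have "\<exists>D\<in>F. r \<in> D"
  proof (cases "r \<in> D0")
    case False
    then obtain D' where "D' \<in> F" "s \<notin> D'"
      using root[OF \<open>D0 \<in> F\<close>] evict[OF \<open>D0 \<in> F\<close>, of s] by blast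
    then show ?thesis using root by blast
  qed (use \<open>D0 \<in> F\<close> in blast)
  then obtain D where D: "D \<in> F" "r \<in> D" by blast
  have sub: "D \<subseteq> verts G" using dom D dominating_setD by blast
  then have fin: "finite D" using finite_subset finite_verts by blast
  have "min_edges s \<le> card (D \<inter> subtree s)"
    using eviction_subtree_bound[OF dominating_setD(1)[OF dom] dominating_setD(2)[OF dom] evict s D(1)]
    by blast
  moreover have "1 + card (D \<inter> subtree s) = card (D \<inter> subtree r)"
    using card_Int_subtree[OF fin, of r] D(2) r by simp
  moreover have "D \<inter> subtree r = D" using sub subtree_root by auto
  ultimately show ?thesis using card D by simp
qed

end

theorem corollary12:
  fixes T :: "('a, 'b) pre_digraph"
  assumes "graph T"
    and "undirected_tree T"
    and "2 \<le> card (verts T)"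
    and "weak_graph T"
  shows "swap_number T = min_star_weight T \<and> min_star_weight T = eviction_number T"
proof -
  interpret graph T by fact
  \<comment> \<open>A leaf to root at is found by first rooting at an arbitrary \<open>r0\<close>: a
    deepest vertex other than \<open>r0\<close> has no children.\<close>
  have leaf_root: "\<exists>r. leaf T r"
  proof -
    obtain r0 where "r0 \<in> verts T" using assms(3) by fastforce
    then obtain par depth where "rooted_tree (verts T) (dominates T) r0 par depth"
      using undirected_tree_rooted assms(2) by blast
    then interpret rooted_tree_graph T r0 par depth
      using assms(1) by (intro rooted_tree_graph.intro)
    have "verts T - {r0} \<noteq> {}"
    proof
      assume "verts T - {r0} = {}"
      then have "card (verts T) \<le> card {r0}" by (intro card_mono) auto
      then show False using assms(3) by simp
    qed
    then have "Max (depth ` (verts T - {r0})) \<in> depth ` (verts T - {r0})"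
      by (intro Max_in) auto
    then obtain l where l: "l \<in> verts T - {r0}" "Max (depth ` (verts T - {r0})) = depth l" by blast
    have "depth v \<le> depth l" if "v \<in> verts T - {r0}" for v
      using that unfolding l(2)[symmetric] by (intro Max_ge) auto
    then have "children l = {}" using childrenD(1,2,5) not_le by blast
    then show ?thesis using leaf_iff_no_children l(1) by blast
  qed
  then obtain r where r: "leaf T r" by blast
  then have rV: "r \<in> verts T" and deg: "card {w. r \<rightarrow>\<^bsub>T\<^esub> w} = 1"
    by (auto simp: leaf_def out_degree_eq_card)
  then obtain par depth where "rooted_tree (verts T) (dominates T) r par depth"
    using undirected_tree_rooted assms(2) by blast
  then interpret rooted_tree_graph T r par depth
    using assms(1) by (intro rooted_tree_graph.intro)
  have "{w. r \<rightarrow>\<^bsub>T\<^esub> w} = children r"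
    using childrenD(2) by (auto simp: adj_iff_children)
  then obtain s where s: "children r = {s}" using deg by (auto simp: card_1_singleton_iff)
  have weak: "l = l'" if "v \<rightarrow>\<^bsub>T\<^esub> l" "v \<rightarrow>\<^bsub>T\<^esub> l'" "leaf T l" "leaf T l'" for v l l'
  proof -
    have "finite (leaf_neighbours T v)"
      by (rule finite_subset[OF _ finite_verts]) (auto simp: leaf_neighbours_def leaf_def)
    moreover have "card (leaf_neighbours T v) \<le> Suc 0"
      using assms(4) adj_in_verts(1)[OF that(1)] by (fastforce simp: weak_graph_def not_le)
    ultimately show ?thesis using that by (simp add: card_le_Suc0_iff_eq leaf_neighbours_def)
  qed
  have leaf_child: "leaf T w \<and> v \<rightarrow>\<^bsub>T\<^esub> w" if "w \<in> children v" "children w = {}" for v w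
    using that leaf_iff_no_children childrenD(1,2) by (auto simp: adj_iff_children)
  have sr: "s \<rightarrow>\<^bsub>T\<^esub> r" using s by (auto simp: adj_iff_children)
  interpret L: leaf_rooted_tree "verts T" "dominates T" r par depth s
  proof
    show "w = w'" if "w \<in> children v" "w' \<in> children v" "children w = {}" "children w' = {}" for v w w'
      using weak leaf_child that by blast
    show "children w \<noteq> {}" if "w \<in> children s" for w
      using weak[OF _ sr _ r] leaf_child[OF that] childrenD(2)[OF that] by blast
  qed (rule s)
  have dom: "dominating_set T (L.colour_class c)" for c
    using L.colour_class_dominating by (intro dominating_setI) (auto simp: L.colour_class_def)
  have swap: "swap_set T (L.colour_class True)"
    unfolding swap_set_def
  proof (intro conjI exI)
    show "dominating_set T (L.colour_class True)" "dominating_set T (L.colour_class False)"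
      by (rule dom)+
    show "bij_betw L.partner (L.colour_class True) (L.colour_class False)" by (rule L.partner_bij)
    then show "card (L.colour_class True) = card (L.colour_class False)" by (rule bij_betw_same_card)
  qed (use L.partner_props(3) in \<open>auto simp: L.colour_class_def\<close>)
  \<comment> \<open>This value bounds the swap number from above and the other two parameters from
    below; both of these are at most the swap number, so all three agree.\<close>
  let ?m = "enat (min_edges s + 1)"
  have "swap_number T \<le> enat (card (L.colour_class True))"
    unfolding swap_number_def using swap by (intro Inf_lower) blast
  also have "\<dots> \<le> ?m" using L.card_colour_class by simp
  finally have DD: "swap_number T \<le> ?m" .
  have S: "min_star_weight T \<le> swap_number T"
    unfolding min_star_weight_def swap_number_def
    using star_partitioning_of_swap_set by (intro Inf_superset_mono) (clarsimp, metis)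
  have E: "eviction_number T \<le> swap_number T"
    unfolding eviction_number_def swap_number_def
    using swap_set_eviction_family by (intro Inf_superset_mono) blast
  \<comment> \<open>Condition (ii) of a simple star partitioning therefore forces the part
    \<open>{s, r}\<close>.\<close>
  have "leaf_neighbours T s = {r}"
    using weak r sr by (auto simp: leaf_neighbours_def)
  then have pair: "{s, r} \<in> P" if "simple_star_partitioning T P" for P
    using that sr adj_in_verts by (auto simp: simple_star_partitioning_def)
  have S': "?m \<le> min_star_weight T"
    unfolding min_star_weight_def
    using star_partitioning_weight[OF _ s pair] by (intro Inf_greatest) auto
  have E': "?m \<le> eviction_number T"
    unfolding eviction_number_def
    using eviction_family_size[OF _ s] by (intro Inf_greatest) auto
  show ?thesis using DD S E S' E' by auto
qed

end
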